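(* Let $\mathcal T$ be a locally finite tiling of a normed space $X$ by bounded convex bodies, and let $C\in\mathcal T$. Then each point $x\in\partial C$ is a $\Delta$-QP point for $C$. As a consequence, each body in $\mathcal T$ is a polytope.
   Context: All normed spaces are real. A convex body is a closed convex set with non-empty interior. A tiling of $X$ is a collection of convex bodies that cover $X$ and have mutually disjoint interiors. A tiling is locally finite if each $x\in X$ has a neighbourhood that intersects only finitely many elements of the tiling. Given a convex body $C$ in $X$ and $x\in\partial C$, $x$ is a $\Delta$-QP point for $C$ if there exist a neighbourhood $U$ of $x$ and functionals $f_1,\dots,f_n\in X^*$ such that $C\cap U=\bigcap_{k=1}^n\{y\in U: f_k(y)\le f_k(x)\}$. A closed, bounded convex set $C$ in $X$ is a polytope if its intersection with every finite-dimensional linear (equivalently, affine) subspace of $X$ is a finite-dimensional polytope, i.e. the convex hull of finitely many points. *)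

theory Defs
  imports "HOL-Analysis.Analysis"
begin

definition convex_body :: "'a::real_normed_vector set \<Rightarrow> bool" where
  "convex_body C \<longleftrightarrow> closed C \<and> convex C \<and> interior C \<noteq> {}"

definition body_tiling :: "'a::real_normed_vector set set \<Rightarrow> bool" where
  "body_tiling T \<longleftrightarrow>
     (\<forall>C\<in>T. convex_body C) \<and> \<Union>T = UNIV \<and>
     pairwise (\<lambda>C D. interior C \<inter> interior D = {}) T"

text \<open>Neighbourhoods of a point are sets having that point in their interior; they
  need not be open. The functionals range over the topological dual, i.e. the
  \<^emph>\<open>bounded\<close> linear maps into the reals.\<close>

definition Delta_QP_point :: "'a::real_normed_vector set \<Rightarrow> 'a \<Rightarrow> bool" where
  "Delta_QP_point C x \<longleftrightarrow>
     convex_body C \<and> x \<in> frontier C \<and>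
     (\<exists>U (n::nat) (f :: nat \<Rightarrow> 'a \<Rightarrow> real).
        x \<in> interior U \<and> n \<ge> 1 \<and> (\<forall>k\<in>{1..n}. bounded_linear (f k)) \<and>
        C \<inter> U = (\<Inter>k\<in>{1..n}. {y \<in> U. f k y \<le> f k x}))"

text \<open>The library predicate \<^const>\<open>polytope\<close> (convex hull of a finite set) is the
  finite-dimensional notion; in infinite dimensions only finite-dimensional linear
  sections are required to be of that form. \<^term>\<open>span B\<close> for finite \<^term>\<open>B\<close> runs through
  exactly the finite-dimensional linear subspaces.\<close>

definition normed_polytope :: "'a::real_normed_vector set \<Rightarrow> bool" where
  "normed_polytope C \<longleftrightarrow>
     closed C \<and> bounded C \<and> convex C \<and>
     (\<forall>B. finite B \<longrightarrow> polytope (C \<inter> span B))"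

end

theory Submission
  imports Defs
begin

text \<open>
  Fix a tile \<open>C\<close>. By the Hahn--Banach theorem every other tile \<open>D\<close> is separated from \<open>C\<close> by a
  closed hyperplane. Let \<open>U\<close> be an open set that meets only finitely many tiles. Inside \<open>U\<close>,
  the tile \<open>C\<close> is exactly the intersection of the separating half-spaces that contain it: a
  point \<open>y\<close> of that intersection, moved slightly towards an interior point of \<open>C\<close>, satisfies
  all the inequalities strictly and so lies in no tile other than \<open>C\<close>; since the tiles cover
  the space, it lies in \<open>C\<close>, and \<open>C\<close> is closed
  (lemma \<open>tile_cut_by_halfspaces\<close>). Both claims come from a choice of \<open>U\<close>.

  For a boundary point \<open>x\<close>, take for \<open>U\<close> a neighbourhood that meets only tiles containing
  \<open>x\<close>. Then every separating hyperplane passes through \<open>x\<close>, which is the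
  \<open>\<Delta>\<close>-QP property.

  For a finite-dimensional subspace \<open>L\<close>, the section \<open>P = C \<inter> L\<close> is compact, so some open
  \<open>U \<supseteq> P\<close> meets only finitely many tiles. Let \<open>Q\<close> be the polyhedron that the corresponding
  inequalities cut out of \<open>L\<close>. It is convex, hence connected, and \<open>P = Q \<inter> U\<close> is both closed
  and relatively open in \<open>Q\<close>; so \<open>P = Q\<close> if \<open>P\<close> is nonempty, and for
  empty \<open>P\<close> the claim is trivial. It remains to see that a bounded polyhedron is the convex
  hull of finitely many points. This goes by induction on the number of inequalities
  (lemma \<open>bounded_polyhedron_imp_polytope\<close>): unless the polyhedron is at most a point,
  each of its points lies on a chord whose two ends make some inequality tight, that is, lie in
  a face described by fewer inequalities.

  The Hahn--Banach theorem is derived from the fact that a minimal sublinear functional is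
  linear, and separation is obtained by applying it to the distance from a convex cone, which
  is sublinear.
\<close>

section \<open>Sublinear functionals\<close>

definition sublinear :: "('a::real_vector \<Rightarrow> real) \<Rightarrow> bool" where
  "sublinear p \<longleftrightarrow> (\<forall>x y. p (x + y) \<le> p x + p y) \<and> (\<forall>c x. 0 \<le> c \<longrightarrow> p (c *\<^sub>R x) \<le> c * p x)"

lemma sublinear_add: "sublinear p \<Longrightarrow> p (x + y) \<le> p x + p y"
  by (simp add: sublinear_def)

lemma sublinear_0:
  assumes "sublinear p" shows "p 0 = 0"
proof -
  have "p (0 *\<^sub>R 0) \<le> 0 * p 0"
    using assms unfolding sublinear_def by blast
  moreover have "p (0 + 0) \<le> p 0 + p 0"
    using assms by (rule sublinear_add)
  ultimately show ?thesis by simp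
qed

lemma sublinear_scaleR:
  assumes p: "sublinear p" and c: "0 \<le> c" shows "p (c *\<^sub>R x) = c * p x"
proof (cases "c = 0")
  case True
  then show ?thesis using sublinear_0[OF p] by simp
next
  case False
  with c have "c > 0" by simp
  then have "p (inverse c *\<^sub>R (c *\<^sub>R x)) \<le> inverse c * p (c *\<^sub>R x)"
    using p unfolding sublinear_def by (metis inverse_nonnegative_iff_nonnegative c)
  then have "c * p x \<le> p (c *\<^sub>R x)"
    using \<open>c > 0\<close> by (simp add: field_simps)
  moreover have "p (c *\<^sub>R x) \<le> c * p x"
    using p c unfolding sublinear_def by blast
  ultimately show ?thesis by simp
qed

lemma sublinear_minus: "sublinear p \<Longrightarrow> - p (- x) \<le> p x"
  using sublinear_add[of p x "- x"] sublinear_0[of p] by simp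

text \<open>
  The infimum is sublinear when the family is directed in this weak sense. Three functionals
  below are of this form: the infimum of a chain, a functional tilted along a vector, and the
  distance from a convex cone.
\<close>

lemma sublinear_INF:
  fixes q :: "'i \<Rightarrow> 'a::real_vector \<Rightarrow> real"
  assumes "I \<noteq> {}"
    and bdd: "\<And>x. bdd_below ((\<lambda>i. q i x) ` I)"
    and add: "\<And>i j x y. i \<in> I \<Longrightarrow> j \<in> I \<Longrightarrow> \<exists>k\<in>I. q k (x + y) \<le> q i x + q j y"
    and scale: "\<And>i c x. i \<in> I \<Longrightarrow> 0 \<le> c \<Longrightarrow> \<exists>k\<in>I. q k (c *\<^sub>R x) \<le> c * q i x"
  shows "sublinear (\<lambda>x. INF i\<in>I. q i x)"
proof -
  define m where "m = (\<lambda>x. INF i\<in>I. q i x)"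
  have low: "m x \<le> q i x" if "i \<in> I" for i x
    unfolding m_def using bdd that by (rule cINF_lower)
  have great: "b \<le> m x" if "\<And>i. i \<in> I \<Longrightarrow> b \<le> q i x" for b x
    unfolding m_def using \<open>I \<noteq> {}\<close> that by (rule cINF_greatest)
  have "m (x + y) \<le> m x + m y" for x y
  proof -
    have "m (x + y) - q i x \<le> m y" if "i \<in> I" for i
    proof (rule great)
      fix j assume "j \<in> I"
      with add[OF that this, of x y] low show "m (x + y) - q i x \<le> q j y"
        by (smt (verit))
    qed
    then have "m (x + y) - m y \<le> m x"
      by (intro great) (smt (verit))
    then show ?thesis by simp
  qed
  moreover have "m (c *\<^sub>R x) \<le> c * m x" if "0 \<le> c" for c x
  proof -
    have *: "m (c *\<^sub>R x) \<le> c * q i x" if "i \<in> I" for i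
      using scale[OF that \<open>0 \<le> c\<close>, of x] low by (smt (verit))
    show ?thesis
    proof (cases "c = 0")
      case True
      then show ?thesis using * \<open>I \<noteq> {}\<close> by auto
    next
      case False
      with \<open>0 \<le> c\<close> have "c > 0" by simp
      then have "m (c *\<^sub>R x) / c \<le> m x"
        by (intro great) (use * in \<open>simp add: field_simps\<close>)
      then show ?thesis
        using \<open>c > 0\<close> by (simp add: field_simps)
    qed
  qed
  ultimately show ?thesis
    by (simp add: sublinear_def m_def)
qed

text \<open>
  Witness: \<open>r x = inf {q (x + t y) - t q y | t \<ge> 0}\<close>, the standard way to lower \<open>q\<close> unless it
  already is additive along \<open>y\<close>. The last property is the case \<open>t = 1\<close>; at \<open>x = - y\<close> it
  reads \<open>r (- y) \<le> - q y\<close>.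
\<close>

lemma sublinear_tilt:
  assumes q: "sublinear q"
  obtains r where "sublinear r" "\<And>x. r x \<le> q x" "\<And>x. r x \<le> q (x + y) - q y"
proof
  define r where "r = (\<lambda>x. INF t\<in>{0..}. q (x + t *\<^sub>R y) - t * q y)"
  have bdd: "bdd_below ((\<lambda>t. q (x + t *\<^sub>R y) - t * q y) ` {0..})" for x
  proof (rule bdd_belowI2)
    fix t :: real assume "t \<in> {0..}"
    then have "t * q y = q (t *\<^sub>R y)"
      using sublinear_scaleR[OF q] by simp
    also have "\<dots> \<le> q (x + t *\<^sub>R y) + q (- x)"
      using sublinear_add[OF q, of "x + t *\<^sub>R y" "- x"] by simp
    finally show "- q (- x) \<le> q (x + t *\<^sub>R y) - t * q y"
      by simp
  qed
  show "sublinear r"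
    unfolding r_def
  proof (rule sublinear_INF[OF _ bdd])
    fix s t :: real and x x' assume st: "s \<in> {0..}" "t \<in> {0..}"
    have "q ((x + x') + (s + t) *\<^sub>R y) \<le> q (x + s *\<^sub>R y) + q (x' + t *\<^sub>R y)"
      using sublinear_add[OF q, of "x + s *\<^sub>R y" "x' + t *\<^sub>R y"] by (simp add: algebra_simps)
    then show "\<exists>k\<in>{0..}. q (x + x' + k *\<^sub>R y) - k * q y
        \<le> q (x + s *\<^sub>R y) - s * q y + (q (x' + t *\<^sub>R y) - t * q y)"
      using st by (intro bexI[of _ "s + t"]) (auto simp: algebra_simps)
  next
    fix t c :: real and x assume t: "t \<in> {0..}" and c: "0 \<le> c"
    have "q (c *\<^sub>R x + (c * t) *\<^sub>R y) = c * q (x + t *\<^sub>R y)"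
      using sublinear_scaleR[OF q c, of "x + t *\<^sub>R y"] by (simp add: algebra_simps)
    then show "\<exists>k\<in>{0..}. q (c *\<^sub>R x + k *\<^sub>R y) - k * q y \<le> c * (q (x + t *\<^sub>R y) - t * q y)"
      using t c by (intro bexI[of _ "c * t"]) (auto simp: algebra_simps)
  qed simp
  show "r x \<le> q x" for x
    using cINF_lower[OF bdd, of 0 x] by (simp add: r_def)
  show "r x \<le> q (x + y) - q y" for x
    using cINF_lower[OF bdd, of 1 x] by (simp add: r_def)
qed

text \<open>
  Minimality forces every tilt of \<open>q\<close> to be \<open>q\<close> itself, which gives
  \<open>q x + q y \<le> q (x + y)\<close>, the reverse of subadditivity.
\<close>

lemma linear_if_minimal_sublinear:
  assumes q: "sublinear q"
    and min: "\<And>r. sublinear r \<Longrightarrow> (\<And>x. r x \<le> q x) \<Longrightarrow> r = q"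
  shows "linear q"
proof -
  have add: "q (x + y) = q x + q y" for x y
  proof -
    obtain r where r: "sublinear r" "\<And>x. r x \<le> q x" "\<And>x. r x \<le> q (x + y) - q y"
      using sublinear_tilt[OF q] by blast
    then have "r = q" by (intro min)
    with r(3)[of x] sublinear_add[OF q, of x y] show ?thesis by simp
  qed
  have neg: "q (- x) = - q x" for x
    using add[of x "- x"] sublinear_0[OF q] by simp
  have "q (c *\<^sub>R x) = c *\<^sub>R q x" for c x
  proof (cases "0 \<le> c")
    case True
    then show ?thesis using sublinear_scaleR[OF q] by simp
  next
    case False
    then have "q (- ((- c) *\<^sub>R x)) = - ((- c) * q x)"
      using sublinear_scaleR[OF q, of "- c"] neg by simp
    then show ?thesis by simp
  qed
  with add show ?thesis by (intro linearI)
qed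

text \<open>
  Zorn's lemma. The pointwise infimum of a chain is finite because
  \<open>- p (- x) \<le> - q (- x) \<le> q x\<close> for every sublinear \<open>q \<le> p\<close>.
\<close>

lemma minimal_sublinear_below:
  fixes p :: "'a::real_vector \<Rightarrow> real"
  assumes p: "sublinear p"
  obtains q where "sublinear q" "\<And>x. q x \<le> p x"
    "\<And>r. sublinear r \<Longrightarrow> (\<And>x. r x \<le> q x) \<Longrightarrow> r = q"
proof -
  define A where "A = {q. sublinear q \<and> (\<forall>x. q x \<le> p x)}"
  let ?P = "\<lambda>q r :: 'a \<Rightarrow> real. \<forall>x. r x \<le> q x"
  have po: "partial_order_on A (relation_of ?P A)"
    by (rule partial_order_on_relation_ofI) (auto intro: order_trans simp: fun_eq_iff order_antisym)
  have "\<exists>m\<in>A. \<forall>a\<in>A. ?P m a \<longrightarrow> a = m"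
  proof (rule predicate_Zorn[OF po])
    fix C assume C: "C \<in> Chains (relation_of ?P A)"
    then have CA: "C \<subseteq> A" and chain: "\<And>a b. a \<in> C \<Longrightarrow> b \<in> C \<Longrightarrow> ?P a b \<or> ?P b a"
      by (auto simp: Chains_def relation_of_def)
    show "\<exists>u\<in>A. \<forall>a\<in>C. ?P a u"
    proof (cases "C = {}")
      case True
      then show ?thesis using p by (auto simp: A_def)
    next
      case False
      have sub: "sublinear a" and below: "a x \<le> p x" if "a \<in> C" for a x
        using CA that by (auto simp: A_def)
      have bdd: "bdd_below ((\<lambda>a. a x) ` C)" for x
      proof (rule bdd_belowI2)
        fix a assume "a \<in> C"
        then show "- p (- x) \<le> a x"
          using sublinear_minus[OF sub, of a x] below[of a "- x"] by linarith
      qed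
      define u where "u = (\<lambda>x. INF a\<in>C. a x)"
      have low: "u x \<le> a x" if "a \<in> C" for a x
        unfolding u_def using bdd that by (rule cINF_lower)
      have "sublinear u"
        unfolding u_def
      proof (rule sublinear_INF[OF False bdd])
        fix a b x y assume ab: "a \<in> C" "b \<in> C"
        (* the smaller of the two comparable functionals serves as witness *)
        then obtain m where "m \<in> C" "m x \<le> a x" "m y \<le> b y"
          using chain[OF ab] by blast
        then show "\<exists>k\<in>C. k (x + y) \<le> a x + b y"
          using sublinear_add[OF sub, of m x y] by (intro bexI[of _ m]) linarith+
      next
        fix a :: "'a \<Rightarrow> real" and c x assume "a \<in> C" "(0::real) \<le> c"
        then show "\<exists>k\<in>C. k (c *\<^sub>R x) \<le> c * a x"
          using sublinear_scaleR[OF sub, of a c x] by (intro bexI[of _ a]) auto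
      qed
      moreover have "u x \<le> p x" for x
        using False low below by (meson all_not_in_conv order_trans)
      ultimately show ?thesis
        using low by (auto simp: A_def)
    qed
  qed
  then obtain q where "q \<in> A" and min: "\<And>a. a \<in> A \<Longrightarrow> ?P q a \<Longrightarrow> a = q"
    by blast
  show thesis
  proof
    show "sublinear q" and le: "q x \<le> p x" for x
      using \<open>q \<in> A\<close> by (auto simp: A_def)
    show "r = q" if r: "sublinear r" "\<And>x. r x \<le> q x" for r
    proof (rule min)
      show "r \<in> A"
        using r le by (auto simp: A_def intro: order_trans)
    qed (use r in blast)
  qed
qed

text \<open>
  A linear functional below the tilt \<open>r\<close> of \<open>p\<close> along \<open>z\<close> satisfies
  \<open>- f z = f (- z) \<le> r (- z) \<le> - p z\<close>, so that it attains \<open>p\<close> at \<open>z\<close>.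
\<close>

lemma Hahn_Banach_sublinear:
  assumes p: "sublinear p"
  obtains f where "linear f" "\<And>x. f x \<le> p x" "f z = p z"
proof -
  obtain r where r: "sublinear r" "\<And>x. r x \<le> p x" "\<And>x. r x \<le> p (x + z) - p z"
    using sublinear_tilt[OF p] by blast
  obtain f where f: "sublinear f" "\<And>x. f x \<le> r x"
    "\<And>g. sublinear g \<Longrightarrow> (\<And>x. g x \<le> f x) \<Longrightarrow> g = f"
    using minimal_sublinear_below[OF r(1)] by blast
  have lin: "linear f"
    using f(1,3) by (rule linear_if_minimal_sublinear)
  have "f (- z) \<le> - p z"
    using f(2)[of "- z"] r(3)[of "- z"] sublinear_0[OF p] by simp
  then have "p z \<le> f z"
    using linear_neg[OF lin, of z] by simp
  moreover have le: "f x \<le> p x" for x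
    using f(2) r(2) by (rule order_trans)
  ultimately show thesis
    using that[OF lin le] by (simp add: order_antisym)
qed

section \<open>Separation of convex sets\<close>

text \<open>
  The distance from a convex cone is sublinear, vanishes on the cone, is positive at \<open>z\<close> and is
  dominated by the norm. A linear functional below it with the same value at \<open>z\<close> is therefore
  nonpositive on the cone, positive at \<open>z\<close> and bounded with norm at most 1.
\<close>

lemma separate_point_convex_cone:
  fixes K :: "'a::real_normed_vector set"
  assumes K: "convex_cone K" and z: "z \<notin> closure K"
  obtains f :: "'a \<Rightarrow> real" where "bounded_linear f" "\<And>k. k \<in> K \<Longrightarrow> f k \<le> 0" "0 < f z"
proof -
  have "0 \<in> K"
    using K by (rule convex_cone_contains_0)
  have "sublinear (\<lambda>x. INF k\<in>K. dist x k)"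
  proof (rule sublinear_INF)
    fix k l x y assume kl: "k \<in> K" "l \<in> K"
    then show "\<exists>m\<in>K. dist (x + y) m \<le> dist x k + dist y l"
      using convex_cone_add[OF K kl] by (intro bexI[of _ "k + l"] dist_triangle_add)
  next
    fix k c x assume "k \<in> K" "(0::real) \<le> c"
    then show "\<exists>m\<in>K. dist (c *\<^sub>R x) m \<le> c * dist x k"
      using convex_cone_scaleR[OF K, of c k]
      by (intro bexI[of _ "c *\<^sub>R k"]) (auto simp: dist_norm simp flip: scaleR_diff_right)
  qed (use \<open>0 \<in> K\<close> in auto)
  moreover have "(\<lambda>x. infdist x K) = (\<lambda>x. INF k\<in>K. dist x k)"
    using \<open>0 \<in> K\<close> by (intro ext infdist_notempty) auto
  ultimately have "sublinear (\<lambda>x. infdist x K)"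
    by simp
  then obtain f where f: "linear f" "\<And>x. f x \<le> infdist x K" "f z = infdist z K"
    by (rule Hahn_Banach_sublinear[where z = z]) blast
  have le: "f x \<le> norm x" for x
    using f(2)[of x] infdist_le[OF \<open>0 \<in> K\<close>, of x] by simp
  show thesis
  proof
    show "bounded_linear f"
    proof (rule bounded_linear_intro[where K = 1])
      show "norm (f x) \<le> norm x * 1" for x
        using le[of x] le[of "- x"] linear_neg[OF f(1), of x] by simp
    qed (use f(1) in \<open>simp_all add: linear_add linear_scale\<close>)
    show "f k \<le> 0" if "k \<in> K" for k
      using f(2)[of k] that by simp
    show "0 < f z"
      using z f(3) \<open>0 \<in> K\<close> infdist_nonneg[of z K] in_closure_iff_infdist_zero[of K z]
      by (metis empty_iff order_le_less)
  qed
qed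

text \<open>
  Apply the preceding lemma to the cone generated by the differences \<open>a - b\<close>. The opposite
  \<open>b0 - a0\<close> of one difference stays away from this cone: if a ball about \<open>a0\<close> of radius \<open>r\<close>
  lies in \<open>A\<close>, its distance from the cone is at least \<open>r\<close>, since otherwise
  \<open>A\<close> and \<open>B\<close> would share a point.
\<close>

lemma separate_open_convex:
  fixes A B :: "'a::real_normed_vector set"
  assumes A: "open A" "convex A" "A \<noteq> {}" and B: "convex B" "B \<noteq> {}" and "A \<inter> B = {}"
  obtains f :: "'a \<Rightarrow> real" and \<alpha> where "bounded_linear f" "\<And>a. a \<in> A \<Longrightarrow> f a < \<alpha>" "\<And>b. b \<in> B \<Longrightarrow> \<alpha> \<le> f b"
proof -
  define W where "W = (\<Union>a\<in>A. \<Union>b\<in>B. {a - b})"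
  have "convex W" "W \<noteq> {}"
    using A B by (auto simp: W_def intro: convex_differences)
  define K where "K = convex_cone hull W"
  have K_eq: "K = (\<Union>w\<in>W. \<Union>c\<in>{0..}. {c *\<^sub>R w})"
    using \<open>W \<noteq> {}\<close> \<open>convex W\<close>
    by (simp add: K_def convex_cone_hull_convex_hull_nonempty hull_same)
  obtain a0 b0 where "a0 \<in> A" "b0 \<in> B"
    using A B by blast
  then obtain r where "r > 0" and r: "ball a0 r \<subseteq> A"
    using \<open>open A\<close> open_contains_ball by blast
  have "b0 - a0 \<notin> closure K"
  proof
    assume "b0 - a0 \<in> closure K"
    then obtain k where "k \<in> K" "dist k (b0 - a0) < r"
      using \<open>r > 0\<close> closure_approachable by blast
    then obtain a b c where abc: "a \<in> A" "b \<in> B" "0 \<le> c" and k: "k = c *\<^sub>R (a - b)"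
      by (auto simp: K_eq W_def)
    (* a1 is the point near a0 with a1 + c a = b0 + c b: then dividing by 1 + c
       produces a common point of A and B *)
    define a1 where "a1 = b0 - k"
    have "a0 - a1 = k - (b0 - a0)"
      by (simp add: a1_def)
    then have "a1 \<in> A"
      using \<open>dist k (b0 - a0) < r\<close> r by (metis dist_norm mem_ball subset_iff)
    have pos: "0 < 1 + c" using abc by simp
    have wt: "0 \<le> 1 / (1 + c)" "0 \<le> c / (1 + c)" "1 / (1 + c) + c / (1 + c) = 1"
      using abc pos by (auto simp: add_divide_distrib[symmetric])
    have "(1 / (1 + c)) *\<^sub>R a1 + (c / (1 + c)) *\<^sub>R a \<in> A"
      using convexD[OF A(2) \<open>a1 \<in> A\<close> abc(1) wt] .
    moreover have "(1 / (1 + c)) *\<^sub>R b0 + (c / (1 + c)) *\<^sub>R b \<in> B"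
      using convexD[OF B(1) \<open>b0 \<in> B\<close> abc(2) wt] .
    moreover have "(1 / (1 + c)) *\<^sub>R a1 + (c / (1 + c)) *\<^sub>R a
        = (1 / (1 + c)) *\<^sub>R b0 + (c / (1 + c)) *\<^sub>R b"
      by (simp add: a1_def k algebra_simps)
    ultimately show False
      using \<open>A \<inter> B = {}\<close> by auto
  qed
  moreover have "convex_cone K"
    unfolding K_def by (rule convex_cone_convex_cone_hull)
  ultimately obtain f :: "'a \<Rightarrow> real"
    where f: "bounded_linear f" "\<And>k. k \<in> K \<Longrightarrow> f k \<le> 0" "0 < f (b0 - a0)"
    using separate_point_convex_cone by blast
  interpret f: bounded_linear f by (rule f(1))
  have le: "f a \<le> f b" if "a \<in> A" "b \<in> B" for a b
  proof -
    have "a - b \<in> K"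
      using that by (auto simp: K_def W_def intro!: hull_inc)
    then show ?thesis
      using f(2)[of "a - b"] by (simp add: f.diff)
  qed
  have bdd: "bdd_below (f ` B)"
    using le[OF \<open>a0 \<in> A\<close>] by (intro bdd_belowI2)
  show thesis
  proof
    show "bounded_linear f" by (rule f(1))
    show "(INF b\<in>B. f b) \<le> f b" if "b \<in> B" for b
      using bdd that by (rule cINF_lower)
    show "f a < (INF b\<in>B. f b)" if "a \<in> A" for a
    proof -
      (* moving a slightly in the direction b0 - a0 stays in A and increases f *)
      obtain e where "e > 0" and e: "ball a e \<subseteq> A"
        using \<open>open A\<close> \<open>a \<in> A\<close> open_contains_ball by blast
      have nz: "norm (b0 - a0) > 0"
        using f(3) f.zero by (metis less_irrefl zero_less_norm_iff)
      define s where "s = e / 2 / norm (b0 - a0)"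
      have "s > 0" using nz \<open>e > 0\<close> by (simp add: s_def)
      have "norm (s *\<^sub>R (b0 - a0)) < e"
        using nz \<open>e > 0\<close> by (simp add: s_def)
      then have "a + s *\<^sub>R (b0 - a0) \<in> A"
        using e by (auto simp: dist_norm subset_iff)
      then have "f (a + s *\<^sub>R (b0 - a0)) \<le> (INF b\<in>B. f b)"
        using le \<open>B \<noteq> {}\<close> by (intro cINF_greatest)
      moreover have "f (a + s *\<^sub>R (b0 - a0)) = f a + s * f (b0 - a0)"
        by (simp only: f.add f.scaleR real_scaleR_def)
      moreover have "0 < s * f (b0 - a0)"
        using \<open>s > 0\<close> f(3) by simp
      ultimately show ?thesis by linarith
    qed
  qed
qed

lemma convex_interior_segment:
  fixes C :: "'a::real_normed_vector set"
  assumes "convex C" "c \<in> interior C" "y \<in> C" "0 < t" "t \<le> 1"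
  shows "y + t *\<^sub>R (c - y) \<in> interior C"
proof -
  obtain r where "r > 0" and r: "ball c r \<subseteq> C"
    using assms(2) mem_interior by blast
  have "ball (y + t *\<^sub>R (c - y)) (t * r) \<subseteq> C"
  proof
    fix x assume x: "x \<in> ball (y + t *\<^sub>R (c - y)) (t * r)"
    define v where "v = c + (1 / t) *\<^sub>R (x - (y + t *\<^sub>R (c - y)))"
    have "norm (x - (y + t *\<^sub>R (c - y))) < t * r"
      using x by (simp add: dist_norm norm_minus_commute)
    then have "norm ((1 / t) *\<^sub>R (x - (y + t *\<^sub>R (c - y)))) < r"
      using \<open>0 < t\<close> by (simp only: norm_scaleR) (simp add: pos_divide_less_eq mult.commute)
    then have "dist c v < r"
      by (simp add: v_def dist_norm del: norm_scaleR)
    then have "v \<in> C" using r by auto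
    then have "(1 - t) *\<^sub>R y + t *\<^sub>R v \<in> C"
      using convexD[OF assms(1,3) \<open>v \<in> C\<close>, of "1 - t" t] assms(4,5) by simp
    moreover have "(1 - t) *\<^sub>R y + t *\<^sub>R v = x"
      using \<open>0 < t\<close> by (simp add: v_def algebra_simps)
    ultimately show "x \<in> C" by simp
  qed
  then show ?thesis
    using \<open>0 < t\<close> \<open>r > 0\<close> mem_interior by (metis mult_pos_pos)
qed

text \<open>This serves to recover a point of a closed set from points of a segment issuing from it.\<close>

lemma segment_start_in_closure:
  fixes y v :: "'a::real_normed_vector"
  assumes "\<epsilon> > 0" and "\<And>t. 0 < t \<Longrightarrow> t < \<epsilon> \<Longrightarrow> y + t *\<^sub>R v \<in> S"
  shows "y \<in> closure S"
proof (rule Lim_in_closed_set)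
  show "((\<lambda>t. y + t *\<^sub>R v) \<longlongrightarrow> y) (at_right (0::real))"
    by (rule tendsto_eq_intros refl | simp)+
  show "\<forall>\<^sub>F t in at_right 0. y + t *\<^sub>R v \<in> closure S"
    using assms closure_subset by (auto simp: eventually_at_right_field)
qed auto

lemma convex_subset_closure_interior:
  fixes C :: "'a::real_normed_vector set"
  assumes "convex C" "interior C \<noteq> {}"
  shows "C \<subseteq> closure (interior C)"
proof
  fix y assume "y \<in> C"
  obtain c where "c \<in> interior C" using assms(2) by blast
  then show "y \<in> closure (interior C)"
    using convex_interior_segment[OF assms(1) _ \<open>y \<in> C\<close>]
    by (intro segment_start_in_closure[of 1 y "c - y"]) auto
qed

text \<open>
  The interior of \<open>C\<close> misses all of \<open>D\<close>, because \<open>D\<close> is the closure of its interior. The strict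
  inequality on the interior of \<open>C\<close> is what later shows that a point of the half-space, pushed
  towards that interior, lies outside \<open>D\<close>.
\<close>

lemma separate_convex_bodies:
  fixes C D :: "'a::real_normed_vector set"
  assumes C: "convex_body C" and D: "convex_body D" and disj: "interior C \<inter> interior D = {}"
  obtains f :: "'a \<Rightarrow> real" and \<alpha> where "bounded_linear f" "\<And>c. c \<in> C \<Longrightarrow> f c \<le> \<alpha>"
    "\<And>c. c \<in> interior C \<Longrightarrow> f c < \<alpha>" "\<And>d. d \<in> D \<Longrightarrow> \<alpha> \<le> f d"
proof -
  have "interior C \<inter> D = {}"
    using disj open_Int_closure_eq_empty[OF open_interior, of C "interior D"]
      convex_subset_closure_interior[of D] D by (auto simp: convex_body_def)
  moreover have "open (interior C)" "convex (interior C)" "interior C \<noteq> {}" "convex D" "D \<noteq> {}"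
    using C D interior_subset[of D] by (auto simp: convex_body_def convex_interior)
  ultimately obtain f :: "'a \<Rightarrow> real" and \<alpha> where f: "bounded_linear f" "\<And>c. c \<in> interior C \<Longrightarrow> f c < \<alpha>"
    "\<And>d. d \<in> D \<Longrightarrow> \<alpha> \<le> f d"
    using separate_open_convex[of "interior C" D] by metis
  have "continuous_on UNIV f"
    using f(1) by (simp add: linear_continuous_on)
  then have "closed {x. f x \<le> \<alpha>}"
    by (intro closed_Collect_le continuous_on_const)
  then have "closure (interior C) \<subseteq> {x. f x \<le> \<alpha>}"
    using f(2) by (intro closure_minimal) (auto intro: less_imp_le)
  then have "C \<subseteq> {x. f x \<le> \<alpha>}"
    using convex_subset_closure_interior[of C] C by (auto simp: convex_body_def)
  then show thesis
    using that f by blast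
qed

section \<open>A tile as a local intersection of half-spaces\<close>

text \<open>
  The points \<open>w = y + t (c - y)\<close> with \<open>c\<close> interior to \<open>C\<close> satisfy every inequality strictly, so no
  tile in \<open>G\<close> contains them. For small \<open>t > 0\<close> they lie in \<open>U\<close>, which
  only \<open>C\<close> and the tiles in \<open>G\<close> meet, so \<open>w \<in> C\<close>; let \<open>t\<close> tend to 0.
\<close>

lemma tile_cut_by_halfspaces:
  fixes f :: "'a::real_normed_vector set \<Rightarrow> 'a \<Rightarrow> real"
  assumes T: "body_tiling T" and C: "C \<in> T" and U: "open U"
    and G: "G = {D \<in> T. D \<inter> U \<noteq> {}} - {C}"
    and lin: "\<And>D. D \<in> G \<Longrightarrow> bounded_linear (f D)"
    and le: "\<And>D c. D \<in> G \<Longrightarrow> c \<in> C \<Longrightarrow> f D c \<le> \<alpha> D"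
    and less: "\<And>D c. D \<in> G \<Longrightarrow> c \<in> interior C \<Longrightarrow> f D c < \<alpha> D"
    and ge: "\<And>D d. D \<in> G \<Longrightarrow> d \<in> D \<Longrightarrow> \<alpha> D \<le> f D d"
  shows "C \<inter> U = {y \<in> U. \<forall>D\<in>G. f D y \<le> \<alpha> D}"
proof
  show "C \<inter> U \<subseteq> {y \<in> U. \<forall>D\<in>G. f D y \<le> \<alpha> D}"
    using le by blast
  show "{y \<in> U. \<forall>D\<in>G. f D y \<le> \<alpha> D} \<subseteq> C \<inter> U"
  proof
    fix y assume "y \<in> {y \<in> U. \<forall>D\<in>G. f D y \<le> \<alpha> D}"
    then have "y \<in> U" and y: "\<And>D. D \<in> G \<Longrightarrow> f D y \<le> \<alpha> D"
      by auto
    have "closed C" "interior C \<noteq> {}"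
      using T C by (auto simp: body_tiling_def convex_body_def)
    then obtain c where c: "c \<in> interior C" by blast
    obtain r where "r > 0" and r: "ball y r \<subseteq> U"
      using U \<open>y \<in> U\<close> open_contains_ball by blast
    define \<epsilon> where "\<epsilon> = min 1 (r / (1 + norm (c - y)))"
    have "\<epsilon> > 0" using \<open>r > 0\<close> by (simp add: \<epsilon>_def add_pos_nonneg)
    have "y + t *\<^sub>R (c - y) \<in> C" if t: "0 < t" "t < \<epsilon>" for t
    proof -
      define w where "w = y + t *\<^sub>R (c - y)"
      have "t < 1" and "t < r / (1 + norm (c - y))"
        using t by (auto simp: \<epsilon>_def)
      then have "t * (1 + norm (c - y)) < r"
        by (simp add: pos_less_divide_eq add_pos_nonneg)
      then have "norm (t *\<^sub>R (c - y)) < r"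
        using t by (simp add: distrib_left)
      then have "w \<in> U"
        using r by (auto simp: w_def dist_norm subset_iff)
      have "f D w < \<alpha> D" if "D \<in> G" for D
      proof -
        interpret bounded_linear "f D" using lin[OF that] .
        have "f D w = (1 - t) * f D y + t * f D c"
          by (simp add: w_def add diff scaleR algebra_simps)
        also have "\<dots> < (1 - t) * \<alpha> D + t * \<alpha> D"
          using y[OF that] less[OF that c] t \<open>t < 1\<close>
          by (intro add_le_less_mono mult_left_mono mult_strict_left_mono) auto
        finally show ?thesis by (simp add: algebra_simps)
      qed
      then have "w \<notin> D" if "D \<in> G" for D
        using ge[OF that, of w] that by force
      moreover obtain D where "D \<in> T" "w \<in> D"
        using T unfolding body_tiling_def by (metis UNIV_I UnionE)
      ultimately have "w \<in> C"
        using \<open>w \<in> U\<close> unfolding G by blast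
      then show ?thesis by (simp add: w_def)
    qed
    then have "y \<in> closure C"
      using \<open>\<epsilon> > 0\<close> by (rule segment_start_in_closure[rotated])
    then show "y \<in> C \<inter> U"
      using \<open>closed C\<close> \<open>y \<in> U\<close> by simp
  qed
qed

lemma tile_separating_functionals:
  fixes T :: "'a::real_normed_vector set set"
  assumes T: "body_tiling T" and C: "C \<in> T"
  obtains f :: "'a set \<Rightarrow> 'a \<Rightarrow> real" and \<alpha> where
    "\<And>D. D \<in> T - {C} \<Longrightarrow> bounded_linear (f D)"
    "\<And>D c. D \<in> T - {C} \<Longrightarrow> c \<in> C \<Longrightarrow> f D c \<le> \<alpha> D"
    "\<And>D c. D \<in> T - {C} \<Longrightarrow> c \<in> interior C \<Longrightarrow> f D c < \<alpha> D"
    "\<And>D d. D \<in> T - {C} \<Longrightarrow> d \<in> D \<Longrightarrow> \<alpha> D \<le> f D d"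
proof -
  let ?sep = "\<lambda>D (f :: 'a \<Rightarrow> real) \<alpha>. bounded_linear f \<and> (\<forall>c\<in>C. f c \<le> \<alpha>) \<and>
    (\<forall>c\<in>interior C. f c < \<alpha>) \<and> (\<forall>d\<in>D. \<alpha> \<le> f d)"
  have *: "\<forall>D\<in>T - {C}. \<exists>f \<alpha>. ?sep D f \<alpha>"
  proof
    fix D assume D: "D \<in> T - {C}"
    have "convex_body C" "convex_body D"
      using T C D by (simp_all add: body_tiling_def)
    moreover have "interior C \<inter> interior D = {}"
      using T C D by (auto simp only: body_tiling_def dest: pairwiseD)
    ultimately show "\<exists>f \<alpha>. ?sep D f \<alpha>"
      by (rule separate_convex_bodies) blast
  qed
  obtain f where **: "\<forall>D\<in>T - {C}. \<exists>\<alpha>. ?sep D (f D) \<alpha>"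
    using bchoice[OF *] ..
  obtain \<alpha> where sep: "\<forall>D\<in>T - {C}. ?sep D (f D) (\<alpha> D)"
    using bchoice[OF **] ..
  show thesis
    by (rule that[of f \<alpha>]) (use sep in blast)+
qed

lemma Delta_QP_point_tile:
  fixes T :: "'a::real_normed_vector set set"
  assumes T: "body_tiling T" and fin: "locally_finite_in euclidean T"
    and C: "C \<in> T" and x: "x \<in> frontier C"
  shows "Delta_QP_point C x"
proof -
  have closed: "closed D" if "D \<in> T" for D
    using T that by (auto simp: body_tiling_def convex_body_def)
  have "x \<in> C"
    using x closed[OF C] by (simp add: frontier_def)
  obtain V where V: "open V" "x \<in> V" and finV: "finite {D \<in> T. D \<inter> V \<noteq> {}}"
    using fin by (auto simp: locally_finite_in_def)
  (* Away from the finitely many closed tiles that miss x, every remaining tile contains x,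
     so that C and the tile force the separating constant to be the value at x. *)
  define U where "U = V - \<Union>{D \<in> T. D \<inter> V \<noteq> {} \<and> x \<notin> D}"
  have "finite {D \<in> T. D \<inter> V \<noteq> {} \<and> x \<notin> D}"
    using finV by (rule rev_finite_subset) auto
  then have "open U"
    unfolding U_def using V closed by (intro open_Diff closed_Union) auto
  have "x \<in> U" using V by (auto simp: U_def)
  define G where "G = {D \<in> T. D \<inter> U \<noteq> {}} - {C}"
  have "finite G"
    using finV by (rule rev_finite_subset) (auto simp: G_def U_def)
  have xG: "x \<in> D" if "D \<in> G" for D
    using that by (auto simp: G_def U_def)
  have GT: "D \<in> T - {C}" if "D \<in> G" for D
    using that by (auto simp: G_def)
  obtain f :: "'a set \<Rightarrow> 'a \<Rightarrow> real" and \<alpha> where f: "\<And>D. D \<in> T - {C} \<Longrightarrow> bounded_linear (f D)"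
    "\<And>D c. D \<in> T - {C} \<Longrightarrow> c \<in> C \<Longrightarrow> f D c \<le> \<alpha> D"
    "\<And>D c. D \<in> T - {C} \<Longrightarrow> c \<in> interior C \<Longrightarrow> f D c < \<alpha> D"
    "\<And>D d. D \<in> T - {C} \<Longrightarrow> d \<in> D \<Longrightarrow> \<alpha> D \<le> f D d"
    using tile_separating_functionals[OF T C] by blast
  have cut: "C \<inter> U = {y \<in> U. \<forall>D\<in>G. f D y \<le> \<alpha> D}"
    by (rule tile_cut_by_halfspaces[OF T C \<open>open U\<close> G_def])
      (rule f(1)[OF GT] f(2)[OF GT] f(3)[OF GT] f(4)[OF GT], assumption+)+
  have \<alpha>: "\<alpha> D = f D x" if "D \<in> G" for D
    using f(2)[OF GT[OF that] \<open>x \<in> C\<close>] f(4)[OF GT[OF that] xG[OF that]] by simp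
  (* At least one functional is required; it exists because x is not interior to C. *)
  have "G \<noteq> {}"
  proof
    assume "G = {}"
    then have "U \<subseteq> C" using cut by auto
    then have "x \<in> interior C"
      using \<open>open U\<close> \<open>x \<in> U\<close> interiorI by blast
    then show False using x by (simp add: frontier_def)
  qed
  obtain h where h: "bij_betw h {1..card G} G"
    using ex_bij_betw_nat_finite_1[OF \<open>finite G\<close>] by blast
  have hG: "h ` {1..card G} = G"
    using h by (simp add: bij_betw_def)
  have "C \<inter> U = {y \<in> U. \<forall>k\<in>{1..card G}. f (h k) y \<le> f (h k) x}"
  proof -
    have "(\<forall>D\<in>G. f D y \<le> \<alpha> D) \<longleftrightarrow> (\<forall>D\<in>h ` {1..card G}. f D y \<le> f D x)" for y
      using \<alpha> hG by simp
    then show ?thesis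
      unfolding cut by (simp only: image_iff ball_simps)
  qed
  also have "\<dots> = (\<Inter>k\<in>{1..card G}. {y \<in> U. f (h k) y \<le> f (h k) x})"
  proof -
    have "1 \<in> {1..card G}"
      using \<open>G \<noteq> {}\<close> \<open>finite G\<close> by (simp add: Suc_le_eq card_gt_0_iff)
    then show ?thesis by blast
  qed
  finally have "C \<inter> U = (\<Inter>k\<in>{1..card G}. {y \<in> U. f (h k) y \<le> f (h k) x})" .
  moreover have "\<forall>k\<in>{1..card G}. bounded_linear (f (h k))"
    using f(1) GT hG by blast
  moreover have "card G \<ge> 1"
    using \<open>G \<noteq> {}\<close> \<open>finite G\<close> by (simp add: Suc_le_eq card_gt_0_iff)
  moreover have "x \<in> interior U"
    using \<open>x \<in> U\<close> \<open>open U\<close> by (simp add: interior_open)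
  moreover have "convex_body C"
    using T C by (simp add: body_tiling_def)
  ultimately show ?thesis
    unfolding Delta_QP_point_def using x by (intro conjI exI[of _ U] exI[of _ "card G"] exI[of _ "\<lambda>k. f (h k)"])
qed

section \<open>Compactness in finite-dimensional subspaces\<close>

lemma closed_if_bounded_parts_in_compact:
  fixes S :: "'a::real_normed_vector set"
  assumes K: "\<And>r. \<exists>K. compact K \<and> K \<subseteq> S \<and> (\<forall>x\<in>S. norm x \<le> r \<longrightarrow> x \<in> K)"
  shows "closed S"
proof (unfold closed_sequential_limits, intro allI impI, elim conjE)
  fix u l assume u: "\<forall>n. u n \<in> S" and l: "u \<longlonglongrightarrow> l"
  have "Bseq u"
    using l by (intro convergent_imp_Bseq) (auto simp: convergent_def)
  then obtain r where r: "\<And>n. norm (u n) \<le> r"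
    unfolding Bseq_def by blast
  obtain K where "compact K" "K \<subseteq> S" and K': "\<forall>x\<in>S. norm x \<le> r \<longrightarrow> x \<in> K"
    using K by blast
  have "closed K" using \<open>compact K\<close> by (rule compact_imp_closed)
  moreover have "u n \<in> K" for n
    using K' u r by blast
  ultimately have "l \<in> K"
    using l by (rule closed_sequentially)
  then show "l \<in> S" using \<open>K \<subseteq> S\<close> by blast
qed

text \<open>
  Induction on \<open>B\<close>. A new vector \<open>b\<close> outside the span of the others has positive distance \<open>\<delta>\<close>
  from that span, which is closed by the induction hypothesis. In \<open>x = t b + y\<close> this bounds the
  coefficient by \<open>\<bar>t\<bar> \<le> norm x / \<delta>\<close> and hence also \<open>y\<close>. Asking for a compact set that
  contains the bounded part, not for compactness of that part, lets a continuous image of a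
  product serve in the induction step.
\<close>

lemma span_bounded_part_in_compact:
  fixes B :: "'a::real_normed_vector set"
  assumes "finite B"
  shows "\<exists>K. compact K \<and> K \<subseteq> span B \<and> (\<forall>x\<in>span B. norm x \<le> r \<longrightarrow> x \<in> K)"
  using assms
proof (induction B arbitrary: r)
  case empty
  show ?case by (intro exI[of _ "{0}"]) auto
next
  case (insert b B)
  show ?case
  proof (cases "b \<in> span B")
    case True
    then show ?thesis using insert.IH by (simp add: span_redundant)
  next
    case False
    have "closed (span B)"
      using insert.IH by (rule closed_if_bounded_parts_in_compact)
    define \<delta> where "\<delta> = infdist b (span B)"
    have "\<delta> > 0"
      unfolding \<delta>_def using \<open>closed (span B)\<close> False span_zero
      by (intro infdist_pos_not_in_closed) auto
    obtain K where K: "compact K" "K \<subseteq> span B"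
      "\<forall>x\<in>span B. norm x \<le> r + r / \<delta> * norm b \<longrightarrow> x \<in> K"
      using insert.IH[of "r + r / \<delta> * norm b"] by (elim exE conjE)
    let ?g = "\<lambda>(t::real, y). t *\<^sub>R b + y"
    have "compact (?g ` ({- (r / \<delta>)..r / \<delta>} \<times> K))"
      using K(1) by (intro compact_continuous_image compact_Times compact_Icc)
        (auto intro!: continuous_intros simp: case_prod_unfold)
    moreover have "?g ` ({- (r / \<delta>)..r / \<delta>} \<times> K) \<subseteq> span (insert b B)"
    proof -
      have "K \<subseteq> span (insert b B)"
        using K(2) span_mono[of B "insert b B"] by blast
      then show ?thesis
        by (fastforce intro: span_add span_scale span_base)
    qed
    moreover have "x \<in> ?g ` ({- (r / \<delta>)..r / \<delta>} \<times> K)"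
      if x: "x \<in> span (insert b B)" "norm x \<le> r" for x
    proof -
      obtain t where t: "x - t *\<^sub>R b \<in> span B"
        using x(1) by (auto simp: span_breakdown_eq)
      define y where "y = x - t *\<^sub>R b"
      have x_eq: "x = t *\<^sub>R b + y" and "y \<in> span B"
        using t by (auto simp: y_def)
      have "\<bar>t\<bar> * \<delta> \<le> norm x"
      proof (cases "t = 0")
        case False
        (* x = t (b - (- y / t)), and the subtracted vector lies in the span *)
        have "- (1 / t) *\<^sub>R y \<in> span B"
          using \<open>y \<in> span B\<close> by (rule span_scale)
        then have "\<delta> \<le> dist b (- (1 / t) *\<^sub>R y)"
          unfolding \<delta>_def by (rule infdist_le)
        also have "\<dots> = norm ((1 / t) *\<^sub>R x)"
          using False by (simp add: x_eq dist_norm algebra_simps)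
        finally show ?thesis
          using False by (simp add: field_simps)
      qed simp
      then have t_le: "\<bar>t\<bar> \<le> r / \<delta>"
        using x(2) \<open>\<delta> > 0\<close> by (simp add: field_simps)
      have "norm y \<le> norm x + \<bar>t\<bar> * norm b"
        using norm_triangle_ineq4[of x "t *\<^sub>R b"] by (simp add: y_def)
      also have "\<dots> \<le> r + r / \<delta> * norm b"
        using x(2) t_le by (intro add_mono mult_right_mono) auto
      finally have "y \<in> K"
        using K(3) \<open>y \<in> span B\<close> by blast
      then show ?thesis
        using t_le x_eq by (intro image_eqI[of _ _ "(t, y)"]) auto
    qed
    ultimately show ?thesis by blast
  qed
qed

lemma closed_span_finite:
  fixes B :: "'a::real_normed_vector set"
  assumes "finite B" shows "closed (span B)"
  using span_bounded_part_in_compact[OF assms] by (rule closed_if_bounded_parts_in_compact)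

lemma compact_Int_span_finite:
  fixes B :: "'a::real_normed_vector set"
  assumes "closed C" "bounded C" "finite B"
  shows "compact (C \<inter> span B)"
proof -
  obtain r where r: "\<And>x. x \<in> C \<Longrightarrow> norm x \<le> r"
    using \<open>bounded C\<close> by (auto simp: bounded_iff)
  obtain K where K: "compact K" "\<forall>x\<in>span B. norm x \<le> r \<longrightarrow> x \<in> K"
    using span_bounded_part_in_compact[OF assms(3), of r] by (elim exE conjE)
  have "compact ((C \<inter> span B) \<inter> K)"
    using assms K(1) by (intro closed_Int_compact closed_Int closed_span_finite)
  moreover have "(C \<inter> span B) \<inter> K = C \<inter> span B"
    using r K(2) by auto
  ultimately show ?thesis by simp
qed

section \<open>Bounded polyhedra\<close>

lemma not_bounded_ray:
  fixes z d :: "'a::real_normed_vector"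
  assumes "bounded S" "d \<noteq> 0"
  obtains t where "0 \<le> t" "z + t *\<^sub>R d \<notin> S"
proof -
  obtain r where r: "\<And>x. x \<in> S \<Longrightarrow> norm x \<le> r"
    using assms(1) by (auto simp: bounded_iff)
  define t where "t = (\<bar>r\<bar> + 1 + norm z) / norm d"
  have "t * norm d = \<bar>r\<bar> + 1 + norm z"
    using assms(2) by (simp add: t_def)
  moreover have "0 \<le> t" by (simp add: t_def)
  moreover have "norm (t *\<^sub>R d) \<le> norm (z + t *\<^sub>R d) + norm z"
    using norm_triangle_ineq4[of "z + t *\<^sub>R d" z] by simp
  ultimately have "norm (z + t *\<^sub>R d) > r" by simp
  then show thesis using that \<open>0 \<le> t\<close> r by fastforce
qed

text \<open>
  The inequality that the ray violates first gives \<open>j\<close>. Only the inequalities with \<open>f i d > 0\<close>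
  can be violated along the ray, and there are some, as otherwise the whole ray would lie in the
  bounded set \<open>P\<close>.
\<close>

lemma ray_exit:
  fixes f :: "'i \<Rightarrow> 'a::real_normed_vector \<Rightarrow> real"
  assumes "finite F" and lin: "\<And>i. i \<in> F \<Longrightarrow> linear (f i)"
    and P: "P = {x \<in> S. \<forall>i\<in>F. f i x \<le> a i}" and "bounded P"
    and "d \<noteq> 0" and line: "\<And>t. z + t *\<^sub>R d \<in> S" and "z \<in> P"
  obtains t j where "0 \<le> t" "j \<in> F" "z + t *\<^sub>R d \<in> P" "f j (z + t *\<^sub>R d) = a j"
proof -
  have f_line: "f i (z + t *\<^sub>R d) = f i z + t * f i d" if "i \<in> F" for i t
    using lin[OF that] by (simp add: linear_add linear_scale)
  define I where "I = {i \<in> F. 0 < f i d}"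
  have zle: "f i z \<le> a i" if "i \<in> F" for i
    using \<open>z \<in> P\<close> that by (auto simp: P)
  define \<tau> where "\<tau> i = (a i - f i z) / f i d" for i
  have "I \<noteq> {}"
  proof
    assume "I = {}"
    have "z + t *\<^sub>R d \<in> P" if "0 \<le> t" for t
    proof -
      have "f i (z + t *\<^sub>R d) \<le> a i" if "i \<in> F" for i
      proof -
        have "t * f i d \<le> 0"
          using \<open>I = {}\<close> \<open>0 \<le> t\<close> that by (auto simp: I_def intro!: mult_nonneg_nonpos)
        then show ?thesis using f_line[OF that] zle[OF that] by simp
      qed
      then show ?thesis using line by (simp add: P)
    qed
    then show False
      using not_bounded_ray[OF \<open>bounded P\<close> \<open>d \<noteq> 0\<close>, of z] by blast
  qed
  moreover have "finite I" using \<open>finite F\<close> by (simp add: I_def)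
  ultimately obtain j where "j \<in> I" and j: "\<And>i. i \<in> I \<Longrightarrow> \<tau> j \<le> \<tau> i"
    using ex_is_arg_min_if_finite[of I \<tau>] by (auto simp: is_arg_min_linorder)
  have jF: "j \<in> F" and jpos: "0 < f j d"
    using \<open>j \<in> I\<close> by (auto simp: I_def)
  have t0: "0 \<le> \<tau> j"
    using zle[OF jF] jpos by (simp add: \<tau>_def)
  have "f i (z + \<tau> j *\<^sub>R d) \<le> a i" if "i \<in> F" for i
  proof (cases "0 < f i d")
    case True
    then have "\<tau> j \<le> \<tau> i" using j that by (simp add: I_def)
    then have "\<tau> j * f i d \<le> a i - f i z"
      using True by (simp add: \<tau>_def[of i] pos_le_divide_eq)
    then show ?thesis using f_line[OF that] by simp
  next
    case False
    then have "\<tau> j * f i d \<le> 0" using t0 by (intro mult_nonneg_nonpos) auto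
    then show ?thesis using f_line[OF that] zle[OF that] by simp
  qed
  then have "z + \<tau> j *\<^sub>R d \<in> P" using line by (simp add: P)
  moreover have "f j (z + \<tau> j *\<^sub>R d) = a j"
    using f_line[OF jF] jpos by (simp add: \<tau>_def)
  ultimately show thesis using that t0 jF by blast
qed

lemma convex_halfspaces:
  fixes f :: "'i \<Rightarrow> 'a::real_vector \<Rightarrow> real"
  assumes "convex S" and lin: "\<And>i. i \<in> F \<Longrightarrow> linear (f i)"
  shows "convex {x \<in> S. \<forall>i\<in>F. f i x \<le> a i}"
proof -
  have "{x \<in> S. \<forall>i\<in>F. f i x \<le> a i} = S \<inter> (\<Inter>i\<in>F. f i -` {..a i})"
    by auto
  moreover have "convex (f i -` {..a i})" if "i \<in> F" for i
    using lin[OF that] by (intro convex_linear_vimage) auto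
  ultimately show ?thesis
    using \<open>convex S\<close> by (simp add: convex_Int convex_INT)
qed

text \<open>
  Allowing an arbitrary affine set \<open>S\<close> as the ambient set makes the induction on the inequalities
  work: a face, where one inequality is tight, is a polyhedron in the affine set
  \<open>{x \<in> S. f j x = a j}\<close> with that inequality removed. If the polyhedron contains two points
  \<open>x \<noteq> y\<close>, the line through any of its points parallel to \<open>y - x\<close> stays in \<open>S\<close> and leaves
  the polyhedron through a face on either side; so the hull of the vertices of all faces is
  everything.
\<close>

lemma bounded_polyhedron_imp_polytope:
  fixes f :: "'i \<Rightarrow> 'a::real_normed_vector \<Rightarrow> real"
  assumes "finite F" "\<And>i. i \<in> F \<Longrightarrow> linear (f i)" "affine S"
    "bounded {x \<in> S. \<forall>i\<in>F. f i x \<le> a i}"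
  shows "polytope {x \<in> S. \<forall>i\<in>F. f i x \<le> a i}"
  using assms
proof (induction F arbitrary: S rule: finite_psubset_induct)
  case (psubset F)
  note lin = psubset.prems(1)
  define P where "P = {x \<in> S. \<forall>i\<in>F. f i x \<le> a i}"
  have "bounded P" using psubset.prems(3) by (simp add: P_def)
  have "convex P"
    unfolding P_def using lin \<open>affine S\<close> by (intro convex_halfspaces affine_imp_convex)
  have face: "polytope {x \<in> P. f j x = a j}" if "j \<in> F" for j
  proof -
    define S' where "S' = {x \<in> S. f j x = a j}"
    have eq: "{x \<in> P. f j x = a j} = {x \<in> S'. \<forall>i\<in>F - {j}. f i x \<le> a i}"
      using that by (auto simp: P_def S'_def)
    have "affine S'"
      using \<open>affine S\<close> lin[OF that]
      by (auto simp: S'_def affine_def linear_add linear_scale simp flip: distrib_right)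
    moreover have "bounded {x \<in> P. f j x = a j}"
      using \<open>bounded P\<close> by (rule bounded_subset) auto
    ultimately show ?thesis
      unfolding eq using that lin by (intro psubset.IH) (auto simp flip: eq)
  qed
  show ?case
  proof (cases "\<exists>x y. x \<in> P \<and> y \<in> P \<and> x \<noteq> y")
    case False
    then have "P = {} \<or> (\<exists>x. P = {x})" by blast
    then have "finite P" by auto
    then show ?thesis
      using hull_same[of convex P] \<open>convex P\<close> unfolding P_def[symmetric] polytope_def by metis
  next
    case True
    then obtain x y where xy: "x \<in> P" "y \<in> P" "x \<noteq> y" by blast
    have line: "z + t *\<^sub>R (y - x) \<in> S" if "z \<in> P" for z t
    proof -
      have "z \<in> S" "x \<in> S" "y \<in> S" using that xy by (auto simp: P_def)
      then show ?thesis using mem_affine_3_minus[OF \<open>affine S\<close>, of z y x t] by simp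
    qed
    have "\<exists>V. \<forall>j\<in>F. finite (V j) \<and> {x \<in> P. f j x = a j} = convex hull (V j)"
      using face unfolding polytope_def by (intro bchoice) blast
    then obtain V where V: "\<And>j. j \<in> F \<Longrightarrow> finite (V j)"
      "\<And>j. j \<in> F \<Longrightarrow> {x \<in> P. f j x = a j} = convex hull (V j)" by blast
    define W where "W = (\<Union>j\<in>F. V j)"
    have faceW: "w \<in> convex hull W" if "j \<in> F" "w \<in> P" "f j w = a j" for j w
    proof -
      have "w \<in> convex hull (V j)" using V(2)[OF that(1)] that by blast
      then show ?thesis
        using hull_mono[of "V j" W] that(1) by (auto simp: W_def)
    qed
    have "z \<in> convex hull W" if zP: "z \<in> P" for z
    proof -
      obtain s i where s: "0 \<le> s" "i \<in> F" "z + s *\<^sub>R (y - x) \<in> P"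
        "f i (z + s *\<^sub>R (y - x)) = a i"
        by (rule ray_exit[OF \<open>finite F\<close> lin P_def \<open>bounded P\<close> _ line[OF zP] zP])
          (use xy in auto)
      obtain t j where t: "0 \<le> t" "j \<in> F" "z + t *\<^sub>R (x - y) \<in> P"
        "f j (z + t *\<^sub>R (x - y)) = a j"
      proof (rule ray_exit[OF \<open>finite F\<close> lin P_def \<open>bounded P\<close> _ _ zP, of "x - y"])
        show "z + t *\<^sub>R (x - y) \<in> S" for t
          using line[OF zP, of "- t"] by (simp add: algebra_simps)
      qed (use xy in auto)
      (* z divides the chord from u to v in the ratio s : t *)
      define u where "u = z + s *\<^sub>R (y - x)"
      define v where "v = z + t *\<^sub>R (x - y)"
      have uv: "u \<in> convex hull W" "v \<in> convex hull W"
        using faceW s t by (auto simp: u_def v_def)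
      show ?thesis
      proof (cases "s + t = 0")
        case True
        then have "z = u" using s t by (simp add: u_def)
        then show ?thesis using uv by simp
      next
        case False
        then have pos: "s + t > 0" using s t by simp
        have "(t / (s + t)) *\<^sub>R u + (s / (s + t)) *\<^sub>R v
            = ((t / (s + t)) + (s / (s + t))) *\<^sub>R z"
          by (simp add: u_def v_def algebra_simps)
        also have wt: "(t / (s + t)) + (s / (s + t)) = 1"
          using pos by (simp add: add_divide_distrib[symmetric] add.commute)
        finally have "z = (t / (s + t)) *\<^sub>R u + (s / (s + t)) *\<^sub>R v" by simp
        then show ?thesis
          using convexD[OF convex_convex_hull uv _ _ wt] s t pos by simp
      qed
    qed
    moreover have "convex hull W \<subseteq> P"
    proof (rule hull_minimal)
      show "W \<subseteq> P"
        using V(2) hull_subset[of "V _" convex] unfolding W_def by blast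
    qed (fact \<open>convex P\<close>)
    ultimately have "P = convex hull W" by blast
    moreover have "finite W" using V(1) \<open>finite F\<close> by (simp add: W_def)
    ultimately show ?thesis
      unfolding P_def[symmetric] polytope_def by blast
  qed
qed

section \<open>Tiles are polytopes\<close>

lemma normed_polytope_tile:
  fixes T :: "'a::real_normed_vector set set"
  assumes T: "body_tiling T" and fin: "locally_finite_in euclidean T"
    and C: "C \<in> T" and bdd: "bounded C"
  shows "normed_polytope C"
proof -
  have clC: "closed C" and "convex C"
    using T C by (auto simp: body_tiling_def convex_body_def)
  have "polytope (C \<inter> span B)" if "finite B" for B
  proof (cases "C \<inter> span B = {}")
    case True
    then show ?thesis by (auto simp: polytope_def)
  next
    case nonempty: False
    define P where "P = C \<inter> span B"
    have "compact P"
      using clC bdd \<open>finite B\<close> by (simp add: P_def compact_Int_span_finite)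
    have "\<forall>x. \<exists>V. open V \<and> x \<in> V \<and> finite {D \<in> T. D \<inter> V \<noteq> {}}"
      using fin by (auto simp: locally_finite_in_def)
    then obtain V where V: "\<And>x. open (V x)" "\<And>x. x \<in> V x" "\<And>x. finite {D \<in> T. D \<inter> V x \<noteq> {}}"
      by metis
    obtain N where N: "N \<subseteq> P" "finite N" "P \<subseteq> (\<Union>x\<in>N. V x)"
      using compactE_image[OF \<open>compact P\<close>, of P V] V by blast
    define U where "U = (\<Union>x\<in>N. V x)"
    have "open U" using V(1) by (auto simp: U_def)
    have "P \<subseteq> U" using N by (simp add: U_def)
    define G where "G = {D \<in> T. D \<inter> U \<noteq> {}} - {C}"
    have "G \<subseteq> (\<Union>x\<in>N. {D \<in> T. D \<inter> V x \<noteq> {}})"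
      by (auto simp: G_def U_def)
    then have "finite G"
      using N(2) V(3) by (auto intro: finite_subset)
    have GT: "D \<in> T - {C}" if "D \<in> G" for D
      using that by (auto simp: G_def)
    obtain f :: "'a set \<Rightarrow> 'a \<Rightarrow> real" and \<alpha> where f: "\<And>D. D \<in> T - {C} \<Longrightarrow> bounded_linear (f D)"
      "\<And>D c. D \<in> T - {C} \<Longrightarrow> c \<in> C \<Longrightarrow> f D c \<le> \<alpha> D"
      "\<And>D c. D \<in> T - {C} \<Longrightarrow> c \<in> interior C \<Longrightarrow> f D c < \<alpha> D"
      "\<And>D d. D \<in> T - {C} \<Longrightarrow> d \<in> D \<Longrightarrow> \<alpha> D \<le> f D d"
      using tile_separating_functionals[OF T C] by blast
    have lin: "linear (f D)" if "D \<in> G" for D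
      using f(1)[OF GT[OF that]] by (rule bounded_linear.linear)
    have cut: "C \<inter> U = {y \<in> U. \<forall>D\<in>G. f D y \<le> \<alpha> D}"
      by (rule tile_cut_by_halfspaces[OF T C \<open>open U\<close> G_def])
        (rule f(1)[OF GT] f(2)[OF GT] f(3)[OF GT] f(4)[OF GT], assumption+)+
    define Q where "Q = {y \<in> span B. \<forall>D\<in>G. f D y \<le> \<alpha> D}"
    have QU: "Q \<inter> U = P"
      using cut \<open>P \<subseteq> U\<close> by (auto simp: Q_def P_def)
    have "convex Q"
      unfolding Q_def using lin by (intro convex_halfspaces subspace_imp_convex subspace_span)
    have "Q = P"
    proof -
      (* U and the complement of P disconnect Q unless one of them misses it. *)
      have "open (- P)"
        using \<open>compact P\<close> by (simp add: compact_imp_closed open_Compl)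
      moreover have "U \<inter> - P \<inter> Q = {}" "Q \<subseteq> U \<union> - P"
        using QU \<open>P \<subseteq> U\<close> by auto
      ultimately have "U \<inter> Q = {} \<or> - P \<inter> Q = {}"
        using connectedD[OF convex_connected[OF \<open>convex Q\<close>] \<open>open U\<close>] by blast
      then show ?thesis
        using QU nonempty by (auto simp: P_def)
    qed
    have "bounded Q"
      using \<open>Q = P\<close> \<open>compact P\<close> by (simp add: compact_imp_bounded)
    then have "polytope Q"
      unfolding Q_def using \<open>finite G\<close> lin
      by (intro bounded_polyhedron_imp_polytope subspace_imp_affine subspace_span)
    then show ?thesis
      using \<open>Q = P\<close> by (simp add: P_def)
  qed
  then show ?thesis
    using clC bdd \<open>convex C\<close> by (simp add: normed_polytope_def)
qed

theorem corollary4p4: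
  fixes T :: "'a::real_normed_vector set set"
  assumes "body_tiling T"
    and "locally_finite_in euclidean T"
    and "\<And>C. C \<in> T \<Longrightarrow> bounded C"
  shows "(\<forall>C\<in>T. \<forall>x\<in>frontier C. Delta_QP_point C x) \<and> (\<forall>C\<in>T. normed_polytope C)"
  using Delta_QP_point_tile[OF assms(1,2)] normed_polytope_tile[OF assms(1,2)] assms(3) by blast

end
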